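(* Let $\Gamma=(V,E)$ be a finite simple graph. Then the regular $\mathcal{J}$-classes of the monoid $\operatorname{MR}(\Gamma)$ are in one-to-one correspondence with the isomorphism classes of induced subgraphs of $\Gamma$. Moreover, the poset of regular $\mathcal{J}$-classes of $\operatorname{MR}(\Gamma)$ (under the usual order $J_a\le J_b \iff MaM\subseteq MbM$, $M=\operatorname{MR}(\Gamma)$) is isomorphic to the poset of isomorphism classes of induced subgraphs of $\Gamma$, where $[\Delta]\le[\Delta']$ if and only if $\Delta$ is isomorphic to an induced subgraph of $\Delta'$.
   Context: For a finite simple graph $\Gamma=(V,E)$, the simplices of $\Gamma$ are the singletons $\{v\}$, $v\in V$, and the edges $\{u,v\}\in E$. The Margolis-Rhodes monoid $\operatorname{MR}(\Gamma)$ is the monoid of all partial functions $f:V\to V$ (acting on the right, composed left to right) such that for every simplex $\sigma$ the full preimage $\sigma f^{-1}=\{v\in\operatorname{Dom}(f)\mid vf\in\sigma\}$ is a simplex or empty. Such $f$ are called continuous. A $\mathcal{J}$-class is regular if it contains a regular element (an $a$ with $a=aba$ for some $b$). The induced subgraph on the empty vertex set is allowed. *)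

theory Defs
  imports "HOL-Algebra.Group"
begin

type_synonym 'a graph = "'a set \<times> 'a set set"

abbreviation verts :: "'a graph \<Rightarrow> 'a set" where "verts \<equiv> fst"
abbreviation edges :: "'a graph \<Rightarrow> 'a set set" where "edges \<equiv> snd"

definition finite_simple_graph :: "'a graph \<Rightarrow> bool" where
  "finite_simple_graph G \<longleftrightarrow>
     finite (verts G) \<and> (\<forall>e\<in>edges G. e \<subseteq> verts G \<and> card e = 2)"

definition simplices :: "'a graph \<Rightarrow> 'a set set" where
  "simplices G = {{v} | v. v \<in> verts G} \<union> edges G"

definition preimage :: "('a \<rightharpoonup> 'a) \<Rightarrow> 'a set \<Rightarrow> 'a set" where
  "preimage f S = {v \<in> dom f. the (f v) \<in> S}"

definition continuous_partial :: "'a graph \<Rightarrow> ('a \<rightharpoonup> 'a) \<Rightarrow> bool" where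
  "continuous_partial G f \<longleftrightarrow> dom f \<subseteq> verts G \<and> ran f \<subseteq> verts G \<and>
     (\<forall>S\<in>simplices G. preimage f S \<in> simplices G \<or> preimage f S = {})"

text \<open>Maps act on the right: the product of \<open>f\<close> and \<open>g\<close> applies \<open>f\<close> first.\<close>

definition MR :: "'a graph \<Rightarrow> ('a \<rightharpoonup> 'a) monoid" where
  "MR G = \<lparr>carrier = {f. continuous_partial G f},
           monoid.mult = (\<lambda>f g. g \<circ>\<^sub>m f),
           one = (\<lambda>v. if v \<in> verts G then Some v else None)\<rparr>"

lemma preimage_map_comp: "preimage (g \<circ>\<^sub>m f) S = preimage f (preimage g S)"
  by (auto simp: preimage_def map_comp_def split: option.splits)

lemma preimage_empty: "preimage f {} = {}"
  by (simp add: preimage_def)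

lemma monoid_MR:
  assumes "finite_simple_graph G"
  shows "monoid (MR G)"
proof (rule monoidI)
  fix f g assume "f \<in> carrier (MR G)" "g \<in> carrier (MR G)"
  then have f: "continuous_partial G f" and g: "continuous_partial G g"
    by (simp_all add: MR_def)
  have "dom (g \<circ>\<^sub>m f) \<subseteq> dom f" "ran (g \<circ>\<^sub>m f) \<subseteq> ran g"
    by (auto simp: map_comp_def ran_def split: option.splits)
  moreover have "preimage (g \<circ>\<^sub>m f) S \<in> simplices G \<or> preimage (g \<circ>\<^sub>m f) S = {}"
    if "S \<in> simplices G" for S
    using f g that unfolding preimage_map_comp continuous_partial_def
    by (metis preimage_empty)
  ultimately show "f \<otimes>\<^bsub>MR G\<^esub> g \<in> carrier (MR G)"
    using f g by (simp add: MR_def continuous_partial_def) (meson subset_trans)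
next
  have "preimage (\<lambda>v. if v \<in> verts G then Some v else None) S = S"
    if "S \<in> simplices G" for S
    using that assms
    by (auto simp: preimage_def simplices_def finite_simple_graph_def split: if_splits)
  then show "\<one>\<^bsub>MR G\<^esub> \<in> carrier (MR G)"
    by (auto simp: MR_def continuous_partial_def ran_def split: if_splits)
next
  fix f assume "f \<in> carrier (MR G)"
  then have f: "dom f \<subseteq> verts G" "ran f \<subseteq> verts G"
    by (simp_all add: MR_def continuous_partial_def)
  show "\<one>\<^bsub>MR G\<^esub> \<otimes>\<^bsub>MR G\<^esub> f = f"
  proof
    fix v
    show "(\<one>\<^bsub>MR G\<^esub> \<otimes>\<^bsub>MR G\<^esub> f) v = f v"
      using f(1) by (cases "f v") (auto simp: MR_def map_comp_def)
  qed
  show "f \<otimes>\<^bsub>MR G\<^esub> \<one>\<^bsub>MR G\<^esub> = f"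
    using f by (auto simp: MR_def map_comp_def fun_eq_iff ran_def split: option.splits)
qed (simp add: MR_def map_comp_def fun_eq_iff split: option.splits)

definition principal_ideal :: "('m, 'b) monoid_scheme \<Rightarrow> 'm \<Rightarrow> 'm set" where
  "principal_ideal M a = {x \<otimes>\<^bsub>M\<^esub> a \<otimes>\<^bsub>M\<^esub> y | x y. x \<in> carrier M \<and> y \<in> carrier M}"

definition J_class :: "('m, 'b) monoid_scheme \<Rightarrow> 'm \<Rightarrow> 'm set" where
  "J_class M a = {b \<in> carrier M. principal_ideal M b = principal_ideal M a}"

definition regular_element :: "('m, 'b) monoid_scheme \<Rightarrow> 'm \<Rightarrow> bool" where
  "regular_element M a \<longleftrightarrow>
     a \<in> carrier M \<and> (\<exists>b\<in>carrier M. a = a \<otimes>\<^bsub>M\<^esub> b \<otimes>\<^bsub>M\<^esub> a)"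

definition regular_J_classes :: "('m, 'b) monoid_scheme \<Rightarrow> 'm set set" where
  "regular_J_classes M = {J_class M a | a. a \<in> carrier M \<and> (\<exists>x\<in>J_class M a. regular_element M x)}"

definition regular_J_order :: "('m, 'b) monoid_scheme \<Rightarrow> 'm set rel" where
  "regular_J_order M =
     {(J_class M a, J_class M b) | a b. a \<in> carrier M \<and> b \<in> carrier M \<and>
        J_class M a \<in> regular_J_classes M \<and> J_class M b \<in> regular_J_classes M \<and>
        principal_ideal M a \<subseteq> principal_ideal M b}"

definition induced_subgraph :: "'a graph \<Rightarrow> 'a graph \<Rightarrow> bool" where
  "induced_subgraph D G \<longleftrightarrow> verts D \<subseteq> verts G \<and> edges D = {e \<in> edges G. e \<subseteq> verts D}"

definition graph_iso :: "'a graph \<Rightarrow> 'a graph \<Rightarrow> bool" where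
  "graph_iso D D' \<longleftrightarrow> (\<exists>\<phi>. bij_betw \<phi> (verts D) (verts D') \<and>
     (\<forall>u\<in>verts D. \<forall>v\<in>verts D. {u, v} \<in> edges D \<longleftrightarrow> {\<phi> u, \<phi> v} \<in> edges D'))"

text \<open>Isomorphism classes are taken within the set of induced subgraphs of \<open>G\<close>.\<close>

definition iso_class :: "'a graph \<Rightarrow> 'a graph \<Rightarrow> 'a graph set" where
  "iso_class G D = {D'. induced_subgraph D' G \<and> graph_iso D D'}"

definition induced_iso_classes :: "'a graph \<Rightarrow> 'a graph set set" where
  "induced_iso_classes G = {iso_class G D | D. induced_subgraph D G}"

definition induced_iso_order :: "'a graph \<Rightarrow> 'a graph set rel" where
  "induced_iso_order G =
     {(iso_class G D, iso_class G D') | D D'. induced_subgraph D G \<and> induced_subgraph D' G \<and>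
        (\<exists>H. induced_subgraph H D' \<and> graph_iso D H)}"

definition order_isomorphism :: "('p \<Rightarrow> 'q) \<Rightarrow> 'p set \<Rightarrow> 'p rel \<Rightarrow> 'q set \<Rightarrow> 'q rel \<Rightarrow> bool" where
  "order_isomorphism \<Phi> P r Q s \<longleftrightarrow> bij_betw \<Phi> P Q \<and>
     (\<forall>x\<in>P. \<forall>y\<in>P. (x, y) \<in> r \<longleftrightarrow> (\<Phi> x, \<Phi> y) \<in> s)"

end

theory Submission
  imports Defs
begin

text \<open>
  Both posets are quotients of one preorder: the embeddability preorder on the induced subgraphs
  of \<open>G\<close>. To a vertex set \<open>W\<close> belongs its partial identity \<open>1\<^sub>W\<close>, which is continuous because a
  subset of a simplex is a simplex or empty.

  \<^item> If \<open>a = a b a\<close>, then \<open>a\<close> lies in the \<open>\<J>\<close>-class of the idempotent \<open>e = a b\<close>. An idempotent map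
    fixes its image \<open>W\<close> pointwise, so \<open>e\<close> and the partial identity of \<open>W\<close> are multiples of each
    other. Hence the regular \<open>\<J>\<close>-classes are exactly the classes of partial identities
    (\<open>regular_J_classes_MR\<close>).
  \<^item> The partial identity of \<open>W\<close> is a multiple \<open>x 1\<^sub>U y\<close> of that of \<open>U\<close> iff the subgraph induced
    on \<open>W\<close> embeds into the one induced on \<open>U\<close> (\<open>principal_ideal_partial_id_subset_iff\<close>). The
    restriction of \<open>x\<close> to \<open>W\<close> is inverted by \<open>y\<close>, and continuity of \<open>x\<close> reflects edges while
    continuity of \<open>y\<close> preserves them; conversely an embedding and its inverse are continuous.

  By finiteness, mutual embeddability of induced subgraphs is isomorphism
  (\<open>graph_iso_iff_embeds\<close>). So the two families of classes, with their orders, are the same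
  quotient of the same preorder, and \<open>quotient_order_isomorphism\<close> applies.
\<close>

section \<open>Partial orders as quotients of a preorder\<close>

lemma quotient_partial_order:
  fixes leq :: "'a \<Rightarrow> 'a \<Rightarrow> bool"
  assumes P: "P = f ` A"
    and r: "r = {(f a, f b) | a b. a \<in> A \<and> b \<in> A \<and> leq a b}"
    and eq: "\<And>a b. a \<in> A \<Longrightarrow> b \<in> A \<Longrightarrow> f a = f b \<longleftrightarrow> leq a b \<and> leq b a"
    and trans: "\<And>a b c. a \<in> A \<Longrightarrow> b \<in> A \<Longrightarrow> c \<in> A \<Longrightarrow> leq a b \<Longrightarrow> leq b c \<Longrightarrow> leq a c"
  shows "partial_order_on P r"
    and "\<And>a b. a \<in> A \<Longrightarrow> b \<in> A \<Longrightarrow> (f a, f b) \<in> r \<longleftrightarrow> leq a b"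
proof -
  show rel: "(f a, f b) \<in> r \<longleftrightarrow> leq a b" if "a \<in> A" "b \<in> A" for a b
  proof
    assume "(f a, f b) \<in> r"
    then obtain a' b' where "a' \<in> A" "b' \<in> A" "f a = f a'" "f b = f b'" "leq a' b'"
      using r by auto
    then show "leq a b"
      using eq trans that by metis
  qed (use r that in auto)
  have sub: "r \<subseteq> P \<times> P"
    using P r by auto
  moreover have "refl_on P r"
    using P rel eq by (auto simp: refl_on_def)
  moreover have "trans r"
  proof (rule transI)
    fix p q s assume "(p, q) \<in> r" "(q, s) \<in> r"
    moreover from this obtain a b c where "a \<in> A" "b \<in> A" "c \<in> A" "p = f a" "q = f b" "s = f c"
      using sub P by blast
    ultimately show "(p, s) \<in> r"
      using rel trans by metis
  qed
  moreover have "antisym r"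
  proof (rule antisymI)
    fix p q assume "(p, q) \<in> r" "(q, p) \<in> r"
    moreover from this obtain a b where "a \<in> A" "b \<in> A" "p = f a" "q = f b"
      using sub P by blast
    ultimately show "p = q"
      using rel eq by simp
  qed
  ultimately show "partial_order_on P r"
    by (simp add: partial_order_on_def preorder_on_def)
qed

text \<open>The isomorphism sends the class \<open>f a\<close> to \<open>g a\<close>; this is independent of \<open>a\<close>, since both maps
  identify the same elements.\<close>

lemma quotient_order_isomorphism:
  assumes "\<And>a b. a \<in> A \<Longrightarrow> b \<in> A \<Longrightarrow> f a = f b \<longleftrightarrow> g a = g b"
    and "\<And>a b. a \<in> A \<Longrightarrow> b \<in> A \<Longrightarrow> (f a, f b) \<in> r \<longleftrightarrow> (g a, g b) \<in> s"
  shows "\<exists>\<Phi>. order_isomorphism \<Phi> (f ` A) r (g ` A) s"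
proof -
  define \<Phi> where "\<Phi> = (\<lambda>p. g (inv_into A f p))"
  have \<Phi>: "\<Phi> (f a) = g a" if "a \<in> A" for a
    unfolding \<Phi>_def using that assms(1) by (metis f_inv_into_f imageI inv_into_into)
  have "inj_on \<Phi> (f ` A)"
    using assms(1) by (auto simp: inj_on_def \<Phi>)
  moreover have "\<Phi> ` f ` A = g ` A"
    by (simp add: \<Phi> image_image)
  ultimately show ?thesis
    using assms(2) by (intro exI[of _ \<Phi>]) (auto simp: order_isomorphism_def bij_betw_def \<Phi>)
qed

section \<open>Principal ideals and regular J-classes of a monoid\<close>

context monoid
begin

lemma principal_ideal_subset_iff:
  assumes "a \<in> carrier G" "b \<in> carrier G"
  shows "principal_ideal G a \<subseteq> principal_ideal G b \<longleftrightarrow>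
    (\<exists>x\<in>carrier G. \<exists>y\<in>carrier G. a = x \<otimes> b \<otimes> y)"
proof
  have "a \<in> principal_ideal G a"
    unfolding principal_ideal_def using assms(1)
    by (auto intro!: exI[of _ \<one>])
  then show "principal_ideal G a \<subseteq> principal_ideal G b \<Longrightarrow>
      \<exists>x\<in>carrier G. \<exists>y\<in>carrier G. a = x \<otimes> b \<otimes> y"
    unfolding principal_ideal_def by blast
next
  assume "\<exists>x\<in>carrier G. \<exists>y\<in>carrier G. a = x \<otimes> b \<otimes> y"
  then obtain x y where xy: "x \<in> carrier G" "y \<in> carrier G" "a = x \<otimes> b \<otimes> y"
    by blast
  show "principal_ideal G a \<subseteq> principal_ideal G b"
  proof
    fix c assume "c \<in> principal_ideal G a"
    then obtain u v where uv: "u \<in> carrier G" "v \<in> carrier G" "c = u \<otimes> a \<otimes> v"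
      unfolding principal_ideal_def by blast
    then have "c = (u \<otimes> x) \<otimes> b \<otimes> (y \<otimes> v)"
      using xy assms(2) by (simp add: m_assoc)
    then show "c \<in> principal_ideal G b"
      unfolding principal_ideal_def using uv xy by blast
  qed
qed

lemma J_class_eq_iff:
  assumes "a \<in> carrier G" "b \<in> carrier G"
  shows "J_class G a = J_class G b \<longleftrightarrow> principal_ideal G a = principal_ideal G b"
  using assms unfolding J_class_def by blast

text \<open>If \<open>a = a b a\<close>, the idempotent is \<open>a b\<close>: it is a multiple of \<open>a\<close>, and \<open>a = (a b) a\<close> is a
  multiple of it.\<close>

lemma regular_element_idempotent:
  assumes "regular_element G a"
  obtains e where "e \<in> carrier G" "e \<otimes> e = e" "principal_ideal G e = principal_ideal G a"
proof -
  obtain b where a: "a \<in> carrier G" and b: "b \<in> carrier G" and aba: "a = a \<otimes> b \<otimes> a"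
    using assms unfolding regular_element_def by blast
  show ?thesis
  proof
    show e: "a \<otimes> b \<in> carrier G"
      using a b by simp
    show "(a \<otimes> b) \<otimes> (a \<otimes> b) = a \<otimes> b"
      using a b aba by (metis m_assoc m_closed)
    have "a \<otimes> b = \<one> \<otimes> a \<otimes> b" "a = \<one> \<otimes> (a \<otimes> b) \<otimes> a"
      using a b aba by simp_all
    then show "principal_ideal G (a \<otimes> b) = principal_ideal G a"
      using principal_ideal_subset_iff a b e by (intro equalityI) blast+
  qed
qed

text \<open>The definition of the order quantifies over arbitrary representatives of regular classes;
  the order can be read off from any family that meets all these classes.\<close>

lemma regular_J_order_representatives:
  assumes "regular_J_classes G = (\<lambda>i. J_class G (e i)) ` I" "\<And>i. i \<in> I \<Longrightarrow> e i \<in> carrier G"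
  shows "regular_J_order G = {(J_class G (e i), J_class G (e j)) | i j.
    i \<in> I \<and> j \<in> I \<and> principal_ideal G (e i) \<subseteq> principal_ideal G (e j)}"
    (is "_ = ?r")
proof
  show "?r \<subseteq> regular_J_order G"
    using assms unfolding regular_J_order_def by blast
  show "regular_J_order G \<subseteq> ?r"
  proof
    fix p assume "p \<in> regular_J_order G"
    then obtain a b where ab: "a \<in> carrier G" "b \<in> carrier G" "p = (J_class G a, J_class G b)"
        "principal_ideal G a \<subseteq> principal_ideal G b"
        "J_class G a \<in> regular_J_classes G" "J_class G b \<in> regular_J_classes G"
      unfolding regular_J_order_def by blast
    then obtain i j where ij: "i \<in> I" "J_class G a = J_class G (e i)"
        "j \<in> I" "J_class G b = J_class G (e j)"
      using assms(1) by auto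
    with ab assms(2) have "principal_ideal G (e i) \<subseteq> principal_ideal G (e j)"
      using J_class_eq_iff by metis
    with ij ab show "p \<in> ?r"
      by blast
  qed
qed

end

section \<open>Embeddings of graphs\<close>

definition induced_on :: "'a graph \<Rightarrow> 'a set \<Rightarrow> 'a graph" where
  "induced_on G W = (W, {e \<in> edges G. e \<subseteq> W})"

definition embeds :: "'a graph \<Rightarrow> 'a graph \<Rightarrow> bool" where
  "embeds D D' \<longleftrightarrow> (\<exists>\<phi>. inj_on \<phi> (verts D) \<and> \<phi> ` verts D \<subseteq> verts D' \<and>
     (\<forall>u\<in>verts D. \<forall>v\<in>verts D. {u, v} \<in> edges D \<longleftrightarrow> {\<phi> u, \<phi> v} \<in> edges D'))"

lemma induced_subgraph_iff_induced_on:
  "induced_subgraph D G \<longleftrightarrow> (\<exists>W\<subseteq>verts G. D = induced_on G W)"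
  by (cases D) (auto simp: induced_subgraph_def induced_on_def)

lemma embeds_iff_iso_induced_subgraph:
  "embeds D D' \<longleftrightarrow> (\<exists>H. induced_subgraph H D' \<and> graph_iso D H)"
proof
  assume "embeds D D'"
  then obtain \<phi> where \<phi>: "inj_on \<phi> (verts D)" "\<phi> ` verts D \<subseteq> verts D'"
      "\<forall>u\<in>verts D. \<forall>v\<in>verts D. {u, v} \<in> edges D \<longleftrightarrow> {\<phi> u, \<phi> v} \<in> edges D'"
    unfolding embeds_def by blast
  have "graph_iso D (induced_on D' (\<phi> ` verts D))"
    unfolding graph_iso_def induced_on_def
    using \<phi> by (intro exI[of _ \<phi>]) (auto simp: bij_betw_def)
  with \<phi>(2) show "\<exists>H. induced_subgraph H D' \<and> graph_iso D H"
    using induced_subgraph_iff_induced_on by blast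
next
  assume "\<exists>H. induced_subgraph H D' \<and> graph_iso D H"
  then obtain H \<phi> where H: "induced_subgraph H D'" and \<phi>: "bij_betw \<phi> (verts D) (verts H)"
      "\<forall>u\<in>verts D. \<forall>v\<in>verts D. {u, v} \<in> edges D \<longleftrightarrow> {\<phi> u, \<phi> v} \<in> edges H"
    unfolding graph_iso_def by blast
  have "\<phi> u \<in> verts H" if "u \<in> verts D" for u
    using \<phi>(1) that by (auto simp: bij_betw_def)
  with H \<phi> show "embeds D D'"
    unfolding embeds_def induced_subgraph_def
    by (intro exI[of _ \<phi>]) (auto simp: bij_betw_def)
qed

lemma embeds_trans:
  assumes "embeds D D'" "embeds D' D''"
  shows "embeds D D''"
proof -
  obtain \<phi> where \<phi>: "inj_on \<phi> (verts D)" "\<phi> ` verts D \<subseteq> verts D'"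
    "\<And>u v. u \<in> verts D \<Longrightarrow> v \<in> verts D \<Longrightarrow> {u, v} \<in> edges D \<longleftrightarrow> {\<phi> u, \<phi> v} \<in> edges D'"
    using assms(1) by (auto simp: embeds_def)
  obtain \<psi> where \<psi>: "inj_on \<psi> (verts D')" "\<psi> ` verts D' \<subseteq> verts D''"
    "\<And>u v. u \<in> verts D' \<Longrightarrow> v \<in> verts D' \<Longrightarrow> {u, v} \<in> edges D' \<longleftrightarrow> {\<psi> u, \<psi> v} \<in> edges D''"
    using assms(2) by (auto simp: embeds_def)
  have "inj_on (\<psi> \<circ> \<phi>) (verts D)"
    using \<phi>(1) inj_on_subset[OF \<psi>(1) \<phi>(2)] by (rule comp_inj_on)
  moreover have "(\<psi> \<circ> \<phi>) ` verts D \<subseteq> verts D''"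
    using \<phi>(2) \<psi>(2) by fastforce
  moreover have "{u, v} \<in> edges D \<longleftrightarrow> {(\<psi> \<circ> \<phi>) u, (\<psi> \<circ> \<phi>) v} \<in> edges D''"
    if "u \<in> verts D" "v \<in> verts D" for u v
  proof -
    have "\<phi> u \<in> verts D'" "\<phi> v \<in> verts D'"
      using \<phi>(2) that by blast+
    then show ?thesis
      using \<phi>(3) \<psi>(3) that by simp
  qed
  ultimately show ?thesis
    unfolding embeds_def by (intro exI[of _ "\<psi> \<circ> \<phi>"]) simp
qed

lemma graph_iso_sym:
  assumes "graph_iso D D'"
  shows "graph_iso D' D"
proof -
  obtain \<phi> where \<phi>: "bij_betw \<phi> (verts D) (verts D')"
      "\<forall>u\<in>verts D. \<forall>v\<in>verts D. {u, v} \<in> edges D \<longleftrightarrow> {\<phi> u, \<phi> v} \<in> edges D'"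
    using assms unfolding graph_iso_def by blast
  show ?thesis
    unfolding graph_iso_def using \<phi>
    by (intro exI[of _ "inv_into (verts D) \<phi>"])
      (auto simp: bij_betw_inv_into bij_betw_inv_into_right bij_betw_apply[OF bij_betw_inv_into])
qed

text \<open>Two mutually embeddable finite graphs have equally many vertices, so an embedding of one into
  the other is already surjective.\<close>

lemma graph_iso_iff_embeds:
  assumes "finite (verts D)" "finite (verts D')"
  shows "graph_iso D D' \<longleftrightarrow> embeds D D' \<and> embeds D' D"
proof
  have "embeds C C'" if "graph_iso C C'" for C C' :: "'a graph"
    using that by (auto simp: graph_iso_def embeds_def bij_betw_def)
  then show "graph_iso D D' \<Longrightarrow> embeds D D' \<and> embeds D' D"
    using graph_iso_sym by blast
next
  assume "embeds D D' \<and> embeds D' D"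
  then obtain \<phi> where \<phi>: "inj_on \<phi> (verts D)" "\<phi> ` verts D \<subseteq> verts D'"
      "\<forall>u\<in>verts D. \<forall>v\<in>verts D. {u, v} \<in> edges D \<longleftrightarrow> {\<phi> u, \<phi> v} \<in> edges D'"
    by (auto simp: embeds_def)
  moreover have "card (verts D') \<le> card (verts D)"
    using \<open>embeds D D' \<and> embeds D' D\<close> card_inj_on_le[OF _ _ assms(1)]
    by (auto simp: embeds_def)
  ultimately have "\<phi> ` verts D = verts D'"
    using assms by (metis card_image card_seteq)
  with \<phi> show "graph_iso D D'"
    unfolding graph_iso_def bij_betw_def by (intro exI[of _ \<phi>]) simp
qed

lemma iso_class_eq_iff:
  assumes "finite (verts G)" "induced_subgraph D G" "induced_subgraph D' G"
  shows "iso_class G D = iso_class G D' \<longleftrightarrow> embeds D D' \<and> embeds D' D"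
proof -
  have fin: "finite (verts H)" if "induced_subgraph H G" for H
    using that assms(1) by (auto simp: induced_subgraph_def intro: finite_subset)
  have iso: "graph_iso H H' \<longleftrightarrow> embeds H H' \<and> embeds H' H"
    if "induced_subgraph H G" "induced_subgraph H' G" for H H'
    using that fin graph_iso_iff_embeds by blast
  have "embeds D' D'"
    unfolding embeds_def by (auto intro!: exI[of _ id])
  show ?thesis
  proof
    assume "iso_class G D = iso_class G D'"
    then have "graph_iso D D'"
      using iso[OF assms(3,3)] \<open>embeds D' D'\<close> assms(3) unfolding iso_class_def by blast
    then show "embeds D D' \<and> embeds D' D"
      using iso assms(2,3) by blast
  next
    assume *: "embeds D D' \<and> embeds D' D"
    have "graph_iso D H \<longleftrightarrow> graph_iso D' H" if "induced_subgraph H G" for H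
      using * that assms(2,3) by (metis iso embeds_trans)
    then show "iso_class G D = iso_class G D'"
      unfolding iso_class_def by blast
  qed
qed

section \<open>Partial identities in the Margolis-Rhodes monoid\<close>

definition partial_id :: "'a set \<Rightarrow> 'a \<rightharpoonup> 'a" where
  "partial_id W = (\<lambda>v. if v \<in> W then Some v else None)"

lemma carrier_MR: "f \<in> carrier (MR G) \<longleftrightarrow> continuous_partial G f"
  by (simp add: MR_def)

lemma mult_MR: "f \<otimes>\<^bsub>MR G\<^esub> g = g \<circ>\<^sub>m f"
  by (simp add: MR_def)

text \<open>Continuity of an injective map: only edges with both ends in the range can fail, as the other
  simplices have at most one preimage point.\<close>

lemma continuous_partial_injective:
  assumes G: "finite_simple_graph G"
    and dom: "dom f \<subseteq> verts G" and ran: "ran f \<subseteq> verts G"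
    and inj: "\<And>u v w. f u = Some w \<Longrightarrow> f v = Some w \<Longrightarrow> u = v"
    and edge: "\<And>u v u' v'. f u = Some u' \<Longrightarrow> f v = Some v' \<Longrightarrow> {u', v'} \<in> edges G \<Longrightarrow> {u, v} \<in> edges G"
  shows "continuous_partial G f"
proof -
  have vertex: "{u} \<in> simplices G" if "f u = Some u'" for u u'
    using that dom by (auto simp: simplices_def)
  have "preimage f S \<in> simplices G \<or> preimage f S = {}" if "S \<in> simplices G" for S
  proof (cases "\<exists>u v. u \<in> preimage f S \<and> v \<in> preimage f S \<and> u \<noteq> v")
    case True
    then obtain u v u' v' where uv: "f u = Some u'" "f v = Some v'" "u \<noteq> v" "u' \<in> S" "v' \<in> S"
      by (auto simp: preimage_def)
    then have "u' \<noteq> v'"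
      using inj by blast
    with uv that have S: "S \<in> edges G"
      by (auto simp: simplices_def)
    then have "card S = 2"
      using G by (simp add: finite_simple_graph_def)
    with uv \<open>u' \<noteq> v'\<close> have "S = {u', v'}"
      by (auto simp: card_2_iff)
    moreover from this have "preimage f S = {u, v}"
      using uv inj by (auto simp: preimage_def)
    ultimately show ?thesis
      using S edge uv by (auto simp: simplices_def)
  next
    case False
    then show ?thesis
    proof (cases "preimage f S = {}")
      case False
      then obtain u where u: "u \<in> preimage f S" by blast
      with \<open>\<not> (\<exists>u v. _ u v)\<close> have "preimage f S = {u}"
        by blast
      with u vertex show ?thesis
        by (auto simp: preimage_def)
    qed simp
  qed
  with dom ran show ?thesis
    by (simp add: continuous_partial_def)
qed

lemma partial_id_in_MR:
  assumes "finite_simple_graph G" "W \<subseteq> verts G"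
  shows "partial_id W \<in> carrier (MR G)"
  unfolding carrier_MR using assms
  by (intro continuous_partial_injective) (auto simp: partial_id_def ran_def split: if_splits)

text \<open>The full preimage of the edge contains \<open>u\<close> and \<open>v\<close>, so it can only be the edge \<open>{u, v}\<close>.\<close>

lemma continuous_partial_reflects_edge:
  assumes G: "finite_simple_graph G" and f: "continuous_partial G f"
    and uv: "f u = Some u'" "f v = Some v'" "u \<noteq> v" and edge: "{u', v'} \<in> edges G"
  shows "{u, v} \<in> edges G"
proof -
  have uv_pre: "u \<in> preimage f {u', v'}" "v \<in> preimage f {u', v'}"
    using uv by (auto simp: preimage_def)
  have "{u', v'} \<in> simplices G"
    using edge by (simp add: simplices_def)
  then have "preimage f {u', v'} \<in> simplices G"
    using f uv_pre unfolding continuous_partial_def by blast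
  with uv_pre uv(3) have pre: "preimage f {u', v'} \<in> edges G"
    by (auto simp: simplices_def)
  then have "card (preimage f {u', v'}) = 2"
    using G by (simp add: finite_simple_graph_def)
  with uv_pre uv(3) have "preimage f {u', v'} = {u, v}"
    by (auto simp: card_2_iff)
  with pre show ?thesis
    by simp
qed

text \<open>An embedding \<open>\<phi>\<close> factors the partial identity of \<open>W\<close> as \<open>\<phi>\<close>, the partial identity of \<open>U\<close>
  and the inverse of \<open>\<phi>\<close>. Conversely, in a factorization \<open>x 1\<^sub>U y\<close> of the partial identity of
  \<open>W\<close>, the map \<open>x\<close> is injective on \<open>W\<close> with left inverse \<open>y\<close>. Pulling edges back along \<open>x\<close> and
  along \<open>y\<close> shows that \<open>x\<close> reflects and preserves edges on \<open>W\<close>.\<close>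

lemma principal_ideal_partial_id_subset_iff:
  assumes G: "finite_simple_graph G" and W: "W \<subseteq> verts G" and U: "U \<subseteq> verts G"
  shows "principal_ideal (MR G) (partial_id W) \<subseteq> principal_ideal (MR G) (partial_id U) \<longleftrightarrow>
    embeds (induced_on G W) (induced_on G U)"
    (is "?ideal \<longleftrightarrow> ?embeds")
proof -
  have ideal: "?ideal \<longleftrightarrow> (\<exists>x y. continuous_partial G x \<and> continuous_partial G y \<and>
      partial_id W = y \<circ>\<^sub>m (partial_id U \<circ>\<^sub>m x))"
    using monoid.principal_ideal_subset_iff[OF monoid_MR[OF G] partial_id_in_MR[OF G W]
        partial_id_in_MR[OF G U]]
    by (simp add: Bex_def carrier_MR mult_MR)
  have no_loop: "{v, v} \<notin> edges G" for v
    using G by (fastforce simp: finite_simple_graph_def)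
  show ?thesis
  proof
    assume ?ideal
    obtain x y where x: "continuous_partial G x" and y: "continuous_partial G y"
      and xy: "partial_id W = y \<circ>\<^sub>m (partial_id U \<circ>\<^sub>m x)"
      using iffD1[OF ideal \<open>?ideal\<close>] by (elim exE conjE)
    have *: "\<exists>v'\<in>U. x v = Some v' \<and> y v' = Some v" if "v \<in> W" for v
      using fun_cong[OF xy, of v] that
      by (auto simp: partial_id_def map_comp_def split: option.splits if_splits)
    define \<phi> where "\<phi> v = the (x v)" for v
    have \<phi>: "\<phi> v \<in> U" "x v = Some (\<phi> v)" "y (\<phi> v) = Some v" if "v \<in> W" for v
      using *[OF that] by (auto simp: \<phi>_def)
    have inj: "inj_on \<phi> W"
      by (rule inj_on_inverseI[of _ "\<lambda>w. the (y w)"]) (simp add: \<phi>)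
    have "{u, v} \<in> edges G \<longleftrightarrow> {\<phi> u, \<phi> v} \<in> edges G" if "u \<in> W" "v \<in> W" for u v
    proof (cases "u = v")
      case True
      then show ?thesis
        using no_loop by simp
    next
      case False
      then have "\<phi> u \<noteq> \<phi> v"
        using inj that by (auto dest: inj_onD)
      then show ?thesis
        using continuous_partial_reflects_edge[OF G x \<phi>(2)[OF that(1)] \<phi>(2)[OF that(2)] False]
          continuous_partial_reflects_edge[OF G y \<phi>(3)[OF that(1)] \<phi>(3)[OF that(2)]]
        by iprover
    qed
    with inj \<phi>(1) show ?embeds
      unfolding embeds_def induced_on_def by (intro exI[of _ \<phi>]) auto
  next
    assume ?embeds
    then obtain \<phi> where inj: "inj_on \<phi> W" and "\<phi> ` W \<subseteq> U"
      and "\<forall>u\<in>W. \<forall>v\<in>W. {u, v} \<in> edges G \<longleftrightarrow> {\<phi> u, \<phi> v} \<in> edges G \<and> {\<phi> u, \<phi> v} \<subseteq> U"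
      unfolding embeds_def induced_on_def by auto
    then have into: "\<phi> v \<in> U" "\<phi> v \<in> verts G" if "v \<in> W" for v
      using that U by auto
    have edge: "{u, v} \<in> edges G \<longleftrightarrow> {\<phi> u, \<phi> v} \<in> edges G" if "u \<in> W" "v \<in> W" for u v
      using that into \<open>\<forall>u\<in>W. \<forall>v\<in>W. _ u v\<close> by simp
    define x where "x = (\<lambda>v. if v \<in> W then Some (\<phi> v) else None)"
    define y where "y = (\<lambda>w. if w \<in> \<phi> ` W then Some (inv_into W \<phi> w) else None)"
    have "continuous_partial G x"
      using W U into inj edge
      by (intro continuous_partial_injective[OF G])
        (auto simp: x_def ran_def dest: inj_onD split: if_splits)
    moreover have "continuous_partial G y"
      using W U into inj edge
      by (intro continuous_partial_injective[OF G])
        (auto simp: y_def ran_def split: if_splits)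
    moreover have "partial_id W = y \<circ>\<^sub>m (partial_id U \<circ>\<^sub>m x)"
    proof
      fix v
      show "partial_id W v = (y \<circ>\<^sub>m (partial_id U \<circ>\<^sub>m x)) v"
        using into inj by (cases "v \<in> W") (simp_all add: partial_id_def x_def y_def map_comp_def)
    qed
    ultimately show ?ideal
      by (intro iffD2[OF ideal] exI[of _ x] exI[of _ y] conjI)
  qed
qed

text \<open>An idempotent \<open>e\<close> with image \<open>W\<close> fixes \<open>W\<close> pointwise, so \<open>e 1\<^sub>W = e\<close> and \<open>1\<^sub>W e = 1\<^sub>W\<close>.\<close>

lemma principal_ideal_idempotent_MR:
  assumes G: "finite_simple_graph G" and e: "e \<in> carrier (MR G)" "e \<otimes>\<^bsub>MR G\<^esub> e = e"
  shows "principal_ideal (MR G) e = principal_ideal (MR G) (partial_id (ran e))"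
proof -
  interpret monoid "MR G"
    by (rule monoid_MR[OF G])
  have "ran e \<subseteq> verts G"
    using e(1) by (simp add: carrier_MR continuous_partial_def)
  then have id: "partial_id (ran e) \<in> carrier (MR G)"
    by (rule partial_id_in_MR[OF G])
  have fixed: "e w = Some w" if "w \<in> ran e" for w
    using that fun_cong[OF e(2)[unfolded mult_MR]]
    by (auto simp: ran_def map_comp_def) (metis option.simps(5))
  have "e \<otimes>\<^bsub>MR G\<^esub> partial_id (ran e) = e"
    by (auto simp: mult_MR map_comp_def partial_id_def fun_eq_iff ran_def split: option.splits)
  then have "e = e \<otimes>\<^bsub>MR G\<^esub> partial_id (ran e) \<otimes>\<^bsub>MR G\<^esub> \<one>\<^bsub>MR G\<^esub>"
    using e by simp
  moreover have "partial_id (ran e) \<otimes>\<^bsub>MR G\<^esub> e = partial_id (ran e)"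
    using fixed by (auto simp: mult_MR map_comp_def partial_id_def fun_eq_iff)
  then have "partial_id (ran e) = partial_id (ran e) \<otimes>\<^bsub>MR G\<^esub> e \<otimes>\<^bsub>MR G\<^esub> \<one>\<^bsub>MR G\<^esub>"
    using id by simp
  ultimately show ?thesis
    using principal_ideal_subset_iff e(1) id one_closed by (intro equalityI) blast+
qed

lemma regular_J_classes_MR:
  assumes G: "finite_simple_graph G"
  shows "regular_J_classes (MR G) =
    (\<lambda>D. J_class (MR G) (partial_id (verts D))) ` {D. induced_subgraph D G}"
    (is "_ = ?classes")
proof -
  interpret monoid "MR G"
    by (rule monoid_MR[OF G])
  show ?thesis
  proof
    show "?classes \<subseteq> regular_J_classes (MR G)"
    proof
      fix C assume "C \<in> ?classes"
      then obtain W where W: "W \<subseteq> verts G" "C = J_class (MR G) (partial_id W)"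
        by (auto simp: induced_subgraph_def)
      have id: "partial_id W \<in> carrier (MR G)"
        using G W by (simp add: partial_id_in_MR)
      have "partial_id W = partial_id W \<otimes>\<^bsub>MR G\<^esub> partial_id W \<otimes>\<^bsub>MR G\<^esub> partial_id W"
        by (auto simp: mult_MR map_comp_def partial_id_def fun_eq_iff)
      with id have "regular_element (MR G) (partial_id W)"
        unfolding regular_element_def by blast
      with id W show "C \<in> regular_J_classes (MR G)"
        unfolding regular_J_classes_def J_class_def by blast
    qed
    show "regular_J_classes (MR G) \<subseteq> ?classes"
    proof
      fix C assume "C \<in> regular_J_classes (MR G)"
      then obtain a b where a: "a \<in> carrier (MR G)" "C = J_class (MR G) a"
          and b: "regular_element (MR G) b" "principal_ideal (MR G) b = principal_ideal (MR G) a"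
        unfolding regular_J_classes_def J_class_def by blast
      obtain e where e: "e \<in> carrier (MR G)" "e \<otimes>\<^bsub>MR G\<^esub> e = e"
          "principal_ideal (MR G) e = principal_ideal (MR G) b"
        using regular_element_idempotent[OF b(1)] by blast
      have "ran e \<subseteq> verts G"
        using e(1) by (simp add: carrier_MR continuous_partial_def)
      then have D: "induced_subgraph (induced_on G (ran e)) G"
        using induced_subgraph_iff_induced_on by blast
      have "C = J_class (MR G) (partial_id (verts (induced_on G (ran e))))"
        using a b e principal_ideal_idempotent_MR[OF G e(1,2)]
        by (simp add: J_class_def induced_on_def)
      with D show "C \<in> ?classes"
        by blast
    qed
  qed
qed

theorem theorem4p3:
  fixes G :: "'a graph"
  assumes "finite_simple_graph G"
  shows "(\<exists>\<Phi>. bij_betw \<Phi> (regular_J_classes (MR G)) (induced_iso_classes G)) \<and>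
    partial_order_on (regular_J_classes (MR G)) (regular_J_order (MR G)) \<and>
    partial_order_on (induced_iso_classes G) (induced_iso_order G) \<and>
    (\<exists>\<Phi>. order_isomorphism \<Phi> (regular_J_classes (MR G)) (regular_J_order (MR G))
      (induced_iso_classes G) (induced_iso_order G))"
proof -
  interpret monoid "MR G"
    by (rule monoid_MR[OF assms])
  define A where "A = {D. induced_subgraph D G}"
  define J where "J D = J_class (MR G) (partial_id (verts D))" for D :: "'a graph"
  have id: "partial_id (verts D) \<in> carrier (MR G)" if "D \<in> A" for D
    using that assms by (auto simp: A_def induced_subgraph_def intro: partial_id_in_MR)
  have ideal: "principal_ideal (MR G) (partial_id (verts D)) \<subseteq>
      principal_ideal (MR G) (partial_id (verts D')) \<longleftrightarrow> embeds D D'"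
    if "D \<in> A" "D' \<in> A" for D D'
  proof -
    obtain W U where "W \<subseteq> verts G" "D = induced_on G W" "U \<subseteq> verts G" "D' = induced_on G U"
      using \<open>D \<in> A\<close> \<open>D' \<in> A\<close> by (auto simp: A_def induced_subgraph_iff_induced_on)
    moreover from this have "verts D = W" "verts D' = U"
      by (simp_all add: induced_on_def)
    ultimately show ?thesis
      using principal_ideal_partial_id_subset_iff[OF assms] by simp
  qed

  have J_classes: "regular_J_classes (MR G) = J ` A"
    unfolding J_def A_def by (rule regular_J_classes_MR[OF assms])
  have J_order: "regular_J_order (MR G) = {(J D, J D') | D D'. D \<in> A \<and> D' \<in> A \<and> embeds D D'}"
    using regular_J_order_representatives[OF J_classes[unfolded J_def] id]
    by (simp add: J_def ideal cong: conj_cong)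
  have J_eq: "J D = J D' \<longleftrightarrow> embeds D D' \<and> embeds D' D" if "D \<in> A" "D' \<in> A" for D D'
    unfolding J_def J_class_eq_iff[OF id[OF that(1)] id[OF that(2)]]
    using that ideal by (simp add: set_eq_subset)

  have iso_classes: "induced_iso_classes G = iso_class G ` A"
    by (auto simp: induced_iso_classes_def A_def)
  have iso_order: "induced_iso_order G =
      {(iso_class G D, iso_class G D') | D D'. D \<in> A \<and> D' \<in> A \<and> embeds D D'}"
    by (simp add: induced_iso_order_def A_def embeds_iff_iso_induced_subgraph)
  have iso_eq: "iso_class G D = iso_class G D' \<longleftrightarrow> embeds D D' \<and> embeds D' D"
    if "D \<in> A" "D' \<in> A" for D D'
    using that assms by (intro iso_class_eq_iff) (auto simp: A_def finite_simple_graph_def)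

  note J_poset = quotient_partial_order[OF J_classes J_order J_eq embeds_trans]
  note iso_poset = quotient_partial_order[OF iso_classes iso_order iso_eq embeds_trans]
  have "\<exists>\<Phi>. order_isomorphism \<Phi> (regular_J_classes (MR G)) (regular_J_order (MR G))
      (induced_iso_classes G) (induced_iso_order G)"
    unfolding J_classes iso_classes
    by (rule quotient_order_isomorphism) (simp_all add: J_eq iso_eq J_poset(2) iso_poset(2))
  moreover from this have "\<exists>\<Phi>. bij_betw \<Phi> (regular_J_classes (MR G)) (induced_iso_classes G)"
    unfolding order_isomorphism_def by (elim exE conjE) (rule exI)
  ultimately show ?thesis
    using J_poset(1) iso_poset(1) by simp
qed

end
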